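(* Let $r\ge 1$ be an integer, $\lambda_r\in\mathbb{C}\setminus\{0,1\}$, and write $r=2r'$ or $r=2r'+1$ with $r'\ge0$ an integer. Let $\lambda^{dX}_{n,m}$ be the coefficients in $P^{d}_n(\lambda_r;r)(x)=\sum_{m=0}^{n}\lambda^{dX}_{n,m}x^m$. Then: \begin{enumerate} \item For $0\le k'\le r'$ (for $r=2r'$ or $r=2r'+1$): $$\lambda^{dX}_{2k',2\nu}=\frac{(-1)^{k'-\nu}}{4^{k'-\nu}}\binom{k'+\nu}{k'-\nu},\ 0\le\nu\le k';\qquad \lambda^{dX}_{2k',2\nu+1}=0,\ 0\le\nu\le k'-1.$$ \item For $0\le k'\le r'-1$ if $r=2r'$, or for $0\le k'\le r'$ if $r=2r'+1$: $$\lambda^{dX}_{2k'+1,2\nu+1}=\frac{(-1)^{k'-\nu}}{4^{k'-\nu}}\binom{k'+\nu+1}{k'-\nu},\ 0\le\nu\le k';\qquad \lambda^{dX}_{2k'+1,2\nu}=0,\ 0\le\nu\le k'.$$ \item For $r'+1\le k'\le r-1$ (for $r=2r'$ or $r=2r'+1$): $\lambda^{dX}_{2k',2\nu+1}=0$ for $0\le\nu\le k'-1$, $$\lambda^{dX}_{2k',2\nu}=\frac{1}{4^{k'-\nu}}\Big\{(-1)^{k'-\nu}\binom{k'+\nu}{k'-\nu}+(1-\lambda_r)\sum_{j=r-k'}^{k'-1}(-1)^{j-\nu}\binom{j+\nu}{j-\nu}\Big\},\quad 0\le\nu\le r-k'-1,$$ $$\lambda^{dX}_{2k',2\nu}=\frac{1}{4^{k'-\nu}}\Big\{(-1)^{k'-\nu}\binom{k'+\nu}{k'-\nu}+(1-\lambda_r)\sum_{j=\nu}^{k'-1}(-1)^{j-\nu}\binom{j+\nu}{j-\nu}\Big\},\quad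 r-k'\le\nu\le k'-1.$$ \item For $r'\le k'\le r-1$ if $r=2r'$, or for $r'+1\le k'\le r-1$ if $r=2r'+1$: $\lambda^{dX}_{2k'+1,2\nu}=0$ for $0\le\nu\le k'$, $$\lambda^{dX}_{2k'+1,2\nu+1}=\frac{1}{4^{k'-\nu}}\Big\{(-1)^{k'-\nu}\binom{k'+\nu+1}{k'-\nu}+(1-\lambda_r)\sum_{j=r-k'-1}^{k'-1}(-1)^{j-\nu}\binom{j+\nu+1}{j-\nu}\Big\},\quad 0\le\nu\le r-k'-2,$$ $$\lambda^{dX}_{2k'+1,2\nu+1}=\frac{1}{4^{k'-\nu}}\Big\{(-1)^{k'-\nu}\binom{k'+\nu+1}{k'-\nu}+(1-\lambda_r)\sum_{j=\nu}^{k'-1}(-1)^{j-\nu}\binom{j+\nu+1}{j-\nu}\Big\},\quad r-k'-1\le\nu\le k'-1.$$ \item For $n\ge 0$: $\lambda^{dX}_{2(n+r),2\nu+1}=0$ for $0\le\nu\le n+r-1$, $$\lambda^{dX}_{2(n+r),2\nu}=\frac{1}{4^{n+r-\nu}}\Big\{(-1)^{n+r-\nu}\binom{n+r+\nu}{n+r-\nu}+(1-\lambda_r)\sum_{j=n}^{n+r-1}(-1)^{j-\nu}\binom{j+\nu}{j-\nu}\Big\},\quad 0\le\nu\le n-1,$$ $$\lambda^{dX}_{2(n+r),2\nu}=\frac{1}{4^{n+r-\nu}}\Big\{(-1)^{n+r-\nu}\binom{n+r+\nu}{n+r-\nu}+(1-\lambda_r)\sum_{j=\nu}^{n+r-1}(-1)^{j-\nu}\binom{j+\nu}{j-\nu}\Big\},\quad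 n\le\nu\le n+r-1;$$ and $\lambda^{dX}_{2(n+r)+1,2\nu}=0$ for $0\le\nu\le n+r$, $$\lambda^{dX}_{2(n+r)+1,2\nu+1}=\frac{1}{4^{n+r-\nu}}\Big\{(-1)^{n+r-\nu}\binom{n+r+\nu+1}{n+r-\nu}+(1-\lambda_r)\sum_{j=n}^{n+r-1}(-1)^{j-\nu}\binom{j+\nu+1}{j-\nu}\Big\},\quad 0\le\nu\le n-1,$$ $$\lambda^{dX}_{2(n+r)+1,2\nu+1}=\frac{1}{4^{n+r-\nu}}\Big\{(-1)^{n+r-\nu}\binom{n+r+\nu+1}{n+r-\nu}+(1-\lambda_r)\sum_{j=\nu}^{n+r-1}(-1)^{j-\nu}\binom{j+\nu+1}{j-\nu}\Big\},\quad n\le\nu\le n+r-1.$$ \end{enumerate}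
   Context: For an integer $r\ge 1$ and $\lambda_r\in\mathbb{C}\setminus\{0,1\}$, the $r$th-perturbed by dilatation sequence $\{P^d_n(\lambda_r;r)\}_{n\ge 0}$ of the monic Chebyshev polynomials of the second kind is the monic sequence with $P^d_0=1$, $P^d_1(x)=x$, $P^d_{n+2}(x)=xP^d_{n+1}(x)-\gamma_{n+1}P^d_n(x)$ for $n\ge 0$, where $\gamma_r=\lambda_r/4$ and $\gamma_{n+1}=1/4$ for $n\ge 0$, $n\ne r-1$. Index ranges whose upper bound is smaller than the lower bound are empty. *)

theory Defs
  imports Complex_Main "HOL-Computational_Algebra.Polynomial"
begin

text \<open>The recurrence coefficients are indexed from 1: \<open>dil_gamma r lam k\<close> is $\gamma_k$ for
  \<open>k \<ge> 1\<close>; its value at 0 is never used. The unperturbed value 1/4 is that of the monic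
  Chebyshev polynomials of the second kind.\<close>

definition dil_gamma :: "nat \<Rightarrow> complex \<Rightarrow> nat \<Rightarrow> complex" where
  "dil_gamma r lam k = (if k = r then lam / 4 else 1 / 4)"

fun cheb_dil :: "nat \<Rightarrow> complex \<Rightarrow> nat \<Rightarrow> complex poly" where
  "cheb_dil r lam 0 = 1"
| "cheb_dil r lam (Suc 0) = [:0, 1:]"
| "cheb_dil r lam (Suc (Suc n)) =
     [:0, 1:] * cheb_dil r lam (Suc n) - smult (dil_gamma r lam (Suc n)) (cheb_dil r lam n)"

definition dil_coeff :: "nat \<Rightarrow> complex \<Rightarrow> nat \<Rightarrow> nat \<Rightarrow> complex" where
  "dil_coeff r lam n m = coeff (cheb_dil r lam n) m"

lemma cheb_dil_monic:
  "degree (cheb_dil r lam n) = n \<and> lead_coeff (cheb_dil r lam n) = 1"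
proof -
  have "(\<forall>m>n. coeff (cheb_dil r lam n) m = 0) \<and> coeff (cheb_dil r lam n) n = 1"
  proof (induction r lam n rule: cheb_dil.induct)
    case (3 r lam n)
    then show ?case by (auto simp: coeff_pCons split: nat.split)
  qed (auto simp: coeff_pCons split: nat.split)
  then have "degree (cheb_dil r lam n) = n" "coeff (cheb_dil r lam n) n = 1"
    by (metis degree_le le_degree le_antisym zero_neq_one, blast)
  then show ?thesis by simp
qed

lemma cheb_dil_expansion:
  "poly (cheb_dil r lam n) x = (\<Sum>m=0..n. dil_coeff r lam n m * x ^ m)"
  using cheb_dil_monic[of r lam n]
  by (simp add: poly_altdef dil_coeff_def atMost_atLeast0)

end

theory Submission
  imports Defs
begin

text \<open>Let $U_n$ be the unperturbed monic Chebyshev polynomials. The perturbation enters the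
  recurrence only at the step producing index $r+1$, where it adds $\frac{1-\lambda}{4} U_{r-1}$;
  from there on the difference obeys the unperturbed recurrence, so
  $P^d_n = U_n + \frac{1-\lambda}{4}\, U_{r-1} U_{n-r-1}$ for $n \ge r+1$. Linearising the product,
  $U_a U_b = \sum_{i \le \min(a,b)} 4^{-i} U_{a+b-2i}$, and reading off coefficients gives the sums;
  the two ranges of $\nu$ record whether the first summands vanish because their degree is
  below the exponent.\<close>

section \<open>Coefficients of the unperturbed polynomials\<close>

fun chebU :: "nat \<Rightarrow> complex poly" where
  "chebU 0 = 1"
| "chebU (Suc 0) = [:0, 1:]"
| "chebU (Suc (Suc n)) = [:0, 1:] * chebU (Suc n) - smult (1 / 4) (chebU n)"

lemma coeff_X_mult:
  fixes p :: "'a::comm_semiring_1 poly"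
  shows "coeff ([:0, 1:] * p) m = (if m = 0 then 0 else coeff p (m - 1))"
  by (cases m) simp_all

lemma X_mult_chebU: "[:0, 1:] * chebU (Suc n) = chebU (Suc (Suc n)) + smult (1 / 4) (chebU n)"
  by simp

lemma coeff_chebU_gt: "n < m \<Longrightarrow> coeff (chebU n) m = 0"
proof (induction n arbitrary: m rule: chebU.induct)
  case (3 n)
  then show ?case unfolding chebU.simps coeff_diff coeff_smult coeff_X_mult by auto
qed (auto simp: coeff_pCons split: nat.split)

text \<open>At the exponent \<open>m\<close> the recurrence becomes Pascal's rule for
  \<open>(m + q) choose q\<close>, each factor -1/4 coming from one descent by two in degree. Taking
  the codegree \<open>2 * q\<close> as parameter avoids truncated subtraction.\<close>

lemma coeff_chebU: "coeff (chebU (m + 2 * q)) m = (-1 / 4) ^ q * of_nat ((m + q) choose q)"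
proof (induction "m + 2 * q" arbitrary: m q rule: less_induct)
  case less
  show ?case
  proof (cases q)
    case 0
    show ?thesis
    proof (cases m rule: chebU.cases)
      case (3 l)
      then have "coeff (chebU (Suc l)) (Suc l) = 1"
        using less[of "Suc l" 0] 0 by simp
      then show ?thesis
        using 0 3 by (simp add: coeff_chebU_gt)
    qed (use 0 in auto)
  next
    case q: (Suc p)
    have rec: "coeff (chebU (m + 2 * q)) m =
        (if m = 0 then 0 else coeff (chebU (Suc (m + 2 * p))) (m - 1)) - coeff (chebU (m + 2 * p)) m / 4"
      using coeff_X_mult[of "chebU (Suc (m + 2 * p))" m] q by simp
    have low: "coeff (chebU (m + 2 * p)) m = (-1 / 4) ^ p * of_nat ((m + p) choose p)"
      using less q by simp
    show ?thesis
    proof (cases m)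
      case 0
      then show ?thesis using rec low q by simp
    next
      case (Suc l)
      have "coeff (chebU (l + 2 * q)) l = (-1 / 4) ^ q * of_nat ((l + q) choose q)"
        using less[of l q] Suc by simp
      moreover have "l + 2 * q = Suc (m + 2 * p)" "m - 1 = l"
        using q Suc by simp_all
      ultimately have high: "coeff (chebU (Suc (m + 2 * p))) (m - 1)
          = (-1 / 4) ^ q * of_nat ((l + q) choose q)"
        by metis
      then show ?thesis unfolding rec low high by (simp add: q Suc algebra_simps)
    qed
  qed
qed

section \<open>Linearisation of products\<close>

text \<open>Multiplying the formula for \<open>Suc a\<close> by X splits each summand into two
  neighbours, \<open>c i\<close> and \<open>c (Suc i)\<close>. Subtracting a quarter of the formula
  for \<open>a\<close> cancels all shifted summands except the last, which is the new top
  term.\<close>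

lemma chebU_mult_le:
  "a \<le> b \<Longrightarrow> chebU a * chebU b = (\<Sum>i\<le>a. smult ((1 / 4) ^ i) (chebU (a + b - 2 * i)))"
proof (induction a rule: chebU.induct)
  case 1
  then show ?case by simp
next
  case 2
  then obtain c where "b = Suc c" by (cases b) auto
  then show ?case using X_mult_chebU[of c] by simp
next
  case (3 a)
  define c where "c i = smult ((1 / 4) ^ i) (chebU (a + 2 + b - 2 * i))" for i
  have shift: "smult ((1 / 4) ^ i) ([:0, 1:] * chebU (Suc a + b - 2 * i)) = c i + c (Suc i)"
    if "i \<le> Suc a" for i
  proof -
    \<comment> \<open>Since \<open>b\<close> is at least \<open>a + 2\<close>, this subtraction is
      not truncated even at \<open>i = Suc a\<close>, so \<open>X_mult_chebU\<close>
      applies.\<close>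
    define l where "l = a + b - 2 * i"
    have l: "Suc a + b - 2 * i = Suc l" "a + 2 + b - 2 * i = Suc (Suc l)"
      "a + 2 + b - 2 * Suc i = l"
      using that 3(3) by (auto simp: l_def)
    show ?thesis unfolding c_def l X_mult_chebU
      by (simp add: smult_add_right mult.commute del: chebU.simps)
  qed
  have "chebU (Suc (Suc a)) * chebU b
      = [:0, 1:] * (chebU (Suc a) * chebU b) - smult (1 / 4) (chebU a * chebU b)"
    unfolding chebU.simps by (simp only: left_diff_distrib mult.assoc mult_smult_left)
  also have "\<dots> = (\<Sum>i\<le>Suc a. smult ((1 / 4) ^ i) ([:0, 1:] * chebU (Suc a + b - 2 * i)))
      - smult (1 / 4) (\<Sum>i\<le>a. smult ((1 / 4) ^ i) (chebU (a + b - 2 * i)))"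
    using 3 by (simp only: Suc_leD sum_distrib_left mult_smult_right)
  also have "(\<Sum>i\<le>Suc a. smult ((1 / 4) ^ i) ([:0, 1:] * chebU (Suc a + b - 2 * i)))
      = (\<Sum>i\<le>Suc a. c i) + (\<Sum>i\<le>Suc a. c (Suc i))"
    unfolding sum.distrib[symmetric] by (intro sum.cong refl shift) simp
  also have "smult (1 / 4) (\<Sum>i\<le>a. smult ((1 / 4) ^ i) (chebU (a + b - 2 * i)))
      = (\<Sum>i\<le>a. c (Suc i))"
    by (rule poly_eqI) (simp add: c_def coeff_sum sum_distrib_left mult.assoc)
  finally show ?case by (simp add: c_def)
qed

lemma chebU_mult:
  "chebU a * chebU b = (\<Sum>i\<le>min a b. smult ((1 / 4) ^ i) (chebU (a + b - 2 * i)))"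
  using chebU_mult_le[of a b] chebU_mult_le[of b a]
  by (cases "a \<le> b") (simp_all add: min_def add.commute mult.commute)

section \<open>The perturbed polynomials\<close>

lemma cheb_dil_unperturbed: "n \<le> r \<Longrightarrow> cheb_dil r lam n = chebU n"
  by (induction n rule: chebU.induct) (auto simp: dil_gamma_def)

text \<open>Here \<open>r = Suc s\<close>, so the index is \<open>r + 1 + m\<close>. The difference
  from \<open>chebU\<close> is 0 at index \<open>r\<close> and a multiple of \<open>chebU s\<close>
  at \<open>r + 1\<close>; continued by the unperturbed recurrence, it grows like
  \<open>chebU m\<close>.\<close>

lemma cheb_dil_perturbed:
  "cheb_dil (Suc s) lam (s + 2 + m)
    = chebU (s + 2 + m) + smult ((1 - lam) / 4) (chebU s * chebU m)"
proof (induction m rule: chebU.induct)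
  case 1
  show ?case
    by (simp add: cheb_dil_unperturbed dil_gamma_def diff_divide_distrib smult_diff_left)
next
  case 2
  have "cheb_dil (Suc s) lam (s + 2) = chebU (s + 2) + smult ((1 - lam) / 4) (chebU s)"
    by (simp add: cheb_dil_unperturbed dil_gamma_def diff_divide_distrib smult_diff_left)
  moreover have "cheb_dil (Suc s) lam (Suc s) = chebU (Suc s)"
    by (simp add: cheb_dil_unperturbed)
  ultimately show ?case
    by (simp add: dil_gamma_def algebra_simps smult_add_right del: mult_pCons_left mult_pCons_right)
next
  case (3 m)
  have "cheb_dil (Suc s) lam (s + 2 + Suc (Suc m)) = [:0, 1:] * cheb_dil (Suc s) lam (s + 2 + Suc m)
      - smult (1 / 4) (cheb_dil (Suc s) lam (s + 2 + m))"
    by (simp add: dil_gamma_def)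
  then show ?case
    unfolding 3
    by (simp add: algebra_simps smult_add_right smult_diff_right
        del: mult_pCons_left mult_pCons_right)
qed

text \<open>Multiplication by X flips parity and a two-step descent keeps it, whatever the
  recurrence coefficients. This settles every vanishing clause of the theorem.\<close>

lemma dil_coeff_parity: "odd (n + m) \<Longrightarrow> dil_coeff r lam n m = 0"
  unfolding dil_coeff_def
proof (induction n arbitrary: m rule: chebU.induct)
  case (3 n)
  then show ?case unfolding cheb_dil.simps coeff_diff coeff_smult coeff_X_mult by auto
qed (auto simp: coeff_pCons odd_pos split: nat.split)

section \<open>Coefficients in the even and odd classes\<close>

lemma coeff_chebU_parity_class:
  assumes "v \<le> k"
  shows "coeff (chebU (2 * k + e)) (2 * v + e)
    = (-1) ^ (k - v) / 4 ^ (k - v) * of_nat ((k + v + e) choose (k - v))"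
proof -
  have "2 * v + e + 2 * (k - v) = 2 * k + e" "2 * v + e + (k - v) = k + v + e"
    using assms by auto
  then show ?thesis
    using coeff_chebU[of "2 * v + e" "k - v"] by (simp only: power_divide)
qed

lemma dil_coeff_unperturbed:
  assumes "2 * k + e \<le> r" and "v \<le> k"
  shows "dil_coeff r lam (2 * k + e) (2 * v + e)
    = (-1) ^ (k - v) / 4 ^ (k - v) * of_nat ((k + v + e) choose (k - v))"
  using assms by (simp add: dil_coeff_def cheb_dil_unperturbed coeff_chebU_parity_class)

text \<open>The parameter \<open>e\<close> is 0 or 1; the truncated subtractions \<open>k - r\<close> and \<open>r - k - e\<close> make
  one lower bound serve both sides of \<open>k = r\<close>.\<close>

lemma dil_coeff_perturbed:
  assumes r: "r \<ge> 1" and e: "e \<le> 1" and rk: "r < 2 * k + e" and vk: "v \<le> k"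
  shows "dil_coeff r lam (2 * k + e) (2 * v + e) =
      1 / 4 ^ (k - v) * ((-1) ^ (k - v) * of_nat ((k + v + e) choose (k - v))
        + (1 - lam) * (\<Sum>j = max v (max (k - r) (r - k - e))..k - 1.
            (-1) ^ (j - v) * of_nat ((j + v + e) choose (j - v))))"
proof -
  define s where "s = r - 1"
  define m where "m = 2 * k + e - r - 1"
  define L where "L = max (k - r) (r - k - e)"
  define g where "g j = (-1) ^ (j - v) * (of_nat ((j + v + e) choose (j - v)) :: complex)" for j
  have s: "r = Suc s" "2 * k + e = s + 2 + m" using r rk by (auto simp: s_def m_def)
  \<comment> \<open>As \<open>s + m = 2 * (k - 1) + e\<close> with \<open>e\<close> at most 1, the
    smaller index is at most \<open>k - 1\<close>. Under \<open>j = k - 1 - i\<close>, the bounds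
    \<open>i <= s\<close> and \<open>i <= m\<close> become \<open>j >= k - r\<close> and
    \<open>j >= r - k - e\<close>.\<close>
  have M: "min s m \<le> k - 1" "k - 1 - min s m = L" "k \<ge> 1"
    using r rk e by (auto simp: s_def m_def L_def)
  have "coeff (chebU s * chebU m) (2 * v + e)
      = (\<Sum>i\<le>min s m. (1 / 4) ^ i * coeff (chebU (s + m - 2 * i)) (2 * v + e))"
    by (simp add: chebU_mult coeff_sum)
  also have "\<dots> = (\<Sum>j = L..k - 1. (1 / 4) ^ (k - 1 - j) * coeff (chebU (2 * j + e)) (2 * v + e))"
  proof (rule sum.reindex_bij_witness[where i = "\<lambda>j. k - 1 - j" and j = "\<lambda>i. k - 1 - i"])
    fix i assume i: "i \<in> {..min s m}"
    then have "i \<le> k - 1" using M(1) by (simp only: atMost_iff)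
    then have "s + m - 2 * i = 2 * (k - 1 - i) + e" "k - 1 - (k - 1 - i) = i"
      using s(2) M(3) by auto
    then show "(1 / 4) ^ (k - 1 - (k - 1 - i)) * coeff (chebU (2 * (k - 1 - i) + e)) (2 * v + e)
        = (1 / 4) ^ i * coeff (chebU (s + m - 2 * i)) (2 * v + e)"
      by simp
  qed (use M in auto)
  \<comment> \<open>For \<open>j < v\<close> the degree \<open>2 * j + e\<close> is below the
    exponent \<open>2 * v + e\<close>.\<close>
  also have "\<dots> = (\<Sum>j = max v L..k - 1. (1 / 4) ^ (k - 1 - j) * coeff (chebU (2 * j + e)) (2 * v + e))"
    by (rule sum.mono_neutral_right) (auto simp: coeff_chebU_gt)
  \<comment> \<open>The powers of 1/4 combine to exponent \<open>k - v - 1\<close>, one short of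
    \<open>k - v\<close>; the resulting 4 cancels the denominator of
    \<open>(1 - lam) / 4\<close>.\<close>
  also have "\<dots> = (\<Sum>j = max v L..k - 1. 4 / 4 ^ (k - v) * g j)"
  proof (rule sum.cong[OF refl])
    fix j assume "j \<in> {max v L..k - 1}"
    then have j: "v \<le> j" "Suc (k - 1 - j + (j - v)) = k - v" using M by auto
    then have "(4::complex) ^ (k - v) = 4 * (4 ^ (k - 1 - j) * 4 ^ (j - v))"
      by (metis power_Suc power_add)
    then show "(1 / 4) ^ (k - 1 - j) * coeff (chebU (2 * j + e)) (2 * v + e) = 4 / 4 ^ (k - v) * g j"
      using j(1) by (simp add: coeff_chebU_parity_class g_def power_divide)
  qed
  finally have "coeff (chebU s * chebU m) (2 * v + e) = 4 / 4 ^ (k - v) * (\<Sum>j = max v L..k - 1. g j)"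
    by (simp add: sum_distrib_left)
  then have "dil_coeff r lam (2 * k + e) (2 * v + e)
      = coeff (chebU (2 * k + e)) (2 * v + e)
        + (1 - lam) / 4 * (4 / 4 ^ (k - v) * (\<Sum>j = max v L..k - 1. g j))"
    unfolding dil_coeff_def s cheb_dil_perturbed by simp
  also have "\<dots> = 1 / 4 ^ (k - v) * ((-1) ^ (k - v) * of_nat ((k + v + e) choose (k - v))
      + (1 - lam) * (\<Sum>j = max v L..k - 1. g j))"
    unfolding coeff_chebU_parity_class[OF vk] by (simp add: distrib_left)
  finally show ?thesis
    unfolding g_def L_def .
qed

theorem theorem4p6:
  fixes r r' :: nat and lam :: complex
  assumes "r \<ge> 1" and "lam \<notin> {0, 1}"
    and "r = 2 * r' \<or> r = 2 * r' + 1"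
  shows
   "(\<forall>k. k \<le> r' \<longrightarrow>
        (\<forall>v. v \<le> k \<longrightarrow>
          dil_coeff r lam (2 * k) (2 * v) = (-1) ^ (k - v) / 4 ^ (k - v) * of_nat ((k + v) choose (k - v)))
      \<and> (\<forall>v. v < k \<longrightarrow>
          dil_coeff r lam (2 * k) (2 * v + 1) = 0))
    \<and> (\<forall>k. (r = 2 * r' \<and> k < r') \<or> (r = 2 * r' + 1 \<and> k \<le> r') \<longrightarrow>
        (\<forall>v. v \<le> k \<longrightarrow>
          dil_coeff r lam (2 * k + 1) (2 * v + 1) = (-1) ^ (k - v) / 4 ^ (k - v) * of_nat ((k + v + 1) choose (k - v)))
      \<and> (\<forall>v. v \<le> k \<longrightarrow>
          dil_coeff r lam (2 * k + 1) (2 * v) = 0))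
    \<and> (\<forall>k. r' + 1 \<le> k \<and> k \<le> r - 1 \<longrightarrow>
        (\<forall>v. v < k \<longrightarrow>
          dil_coeff r lam (2 * k) (2 * v + 1) = 0)
      \<and> (\<forall>v. v < r - k \<longrightarrow>
          dil_coeff r lam (2 * k) (2 * v) =
            1 / 4 ^ (k - v) *
              ((-1) ^ (k - v) * of_nat ((k + v) choose (k - v))
               + (1 - lam) * (\<Sum>j = r - k..k - 1. (-1) ^ (j - v) * of_nat ((j + v) choose (j - v)))))
      \<and> (\<forall>v. r - k \<le> v \<and> v \<le> k - 1 \<longrightarrow>
          dil_coeff r lam (2 * k) (2 * v) =
            1 / 4 ^ (k - v) *
              ((-1) ^ (k - v) * of_nat ((k + v) choose (k - v))
               + (1 - lam) * (\<Sum>j = v..k - 1. (-1) ^ (j - v) * of_nat ((j + v) choose (j - v))))))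
    \<and> (\<forall>k. ((r = 2 * r' \<and> r' \<le> k) \<or> (r = 2 * r' + 1 \<and> r' + 1 \<le> k)) \<and> k \<le> r - 1 \<longrightarrow>
        (\<forall>v. v \<le> k \<longrightarrow>
          dil_coeff r lam (2 * k + 1) (2 * v) = 0)
      \<and> (\<forall>v. v < r - k - 1 \<longrightarrow>
          dil_coeff r lam (2 * k + 1) (2 * v + 1) =
            1 / 4 ^ (k - v) *
              ((-1) ^ (k - v) * of_nat ((k + v + 1) choose (k - v))
               + (1 - lam) * (\<Sum>j = r - k - 1..k - 1. (-1) ^ (j - v) * of_nat ((j + v + 1) choose (j - v)))))
      \<and> (\<forall>v. r - k - 1 \<le> v \<and> v \<le> k - 1 \<longrightarrow>
          dil_coeff r lam (2 * k + 1) (2 * v + 1) =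
            1 / 4 ^ (k - v) *
              ((-1) ^ (k - v) * of_nat ((k + v + 1) choose (k - v))
               + (1 - lam) * (\<Sum>j = v..k - 1. (-1) ^ (j - v) * of_nat ((j + v + 1) choose (j - v))))))
    \<and> (\<forall>n.
        (\<forall>v. v \<le> n + r - 1 \<longrightarrow>
          dil_coeff r lam (2 * (n + r)) (2 * v + 1) = 0)
      \<and> (\<forall>v. v < n \<longrightarrow>
          dil_coeff r lam (2 * (n + r)) (2 * v) =
            1 / 4 ^ (n + r - v) *
              ((-1) ^ (n + r - v) * of_nat ((n + r + v) choose (n + r - v))
               + (1 - lam) * (\<Sum>j = n..n + r - 1. (-1) ^ (j - v) * of_nat ((j + v) choose (j - v)))))
      \<and> (\<forall>v. n \<le> v \<and> v \<le> n + r - 1 \<longrightarrow>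
          dil_coeff r lam (2 * (n + r)) (2 * v) =
            1 / 4 ^ (n + r - v) *
              ((-1) ^ (n + r - v) * of_nat ((n + r + v) choose (n + r - v))
               + (1 - lam) * (\<Sum>j = v..n + r - 1. (-1) ^ (j - v) * of_nat ((j + v) choose (j - v)))))
      \<and> (\<forall>v. v \<le> n + r \<longrightarrow>
          dil_coeff r lam (2 * (n + r) + 1) (2 * v) = 0)
      \<and> (\<forall>v. v < n \<longrightarrow>
          dil_coeff r lam (2 * (n + r) + 1) (2 * v + 1) =
            1 / 4 ^ (n + r - v) *
              ((-1) ^ (n + r - v) * of_nat ((n + r + v + 1) choose (n + r - v))
               + (1 - lam) * (\<Sum>j = n..n + r - 1. (-1) ^ (j - v) * of_nat ((j + v + 1) choose (j - v)))))
      \<and> (\<forall>v. n \<le> v \<and> v \<le> n + r - 1 \<longrightarrow>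
          dil_coeff r lam (2 * (n + r) + 1) (2 * v + 1) =
            1 / 4 ^ (n + r - v) *
              ((-1) ^ (n + r - v) * of_nat ((n + r + v + 1) choose (n + r - v))
               + (1 - lam) * (\<Sum>j = v..n + r - 1. (-1) ^ (j - v) * of_nat ((j + v + 1) choose (j - v))))))"
proof -
  note even_pert = dil_coeff_perturbed[OF assms(1) zero_le_one, unfolded add_0_right diff_zero]
    and odd_pert = dil_coeff_perturbed[OF assms(1) order_refl]
  \<comment> \<open>For \<open>k < r\<close> the difference \<open>k - r\<close> truncates to 0, so
    \<open>r - k - e\<close> is the lower bound; for \<open>k = n + r\<close> it is
    \<open>k - r = n\<close> instead.\<close>
  have C_range: "r < 2 * k" "max (k - r) (r - k) = r - k" "r - k \<le> k"
    if "r' + 1 \<le> k \<and> k \<le> r - 1" for k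
    using that assms(3) by auto
  have D_range: "r < 2 * k + 1" "max (k - r) (r - k - 1) = r - k - 1" "r - k - 1 \<le> k"
    if "((r = 2 * r' \<and> r' \<le> k) \<or> (r = 2 * r' + 1 \<and> r' + 1 \<le> k)) \<and> k \<le> r - 1" for k
    using that assms(3) by auto
  have E_range: "r < 2 * (n + r)" "r < 2 * (n + r) + 1" for n
    using assms(1) by auto
  show ?thesis
    apply (intro conjI allI impI)
    subgoal using assms(3) by (auto intro!: dil_coeff_unperturbed[where e = 0, simplified])
    subgoal by (simp add: dil_coeff_parity)
    subgoal using assms(3) by (intro dil_coeff_unperturbed[where e = 1]) auto
    subgoal by (simp add: dil_coeff_parity)
    subgoal by (simp add: dil_coeff_parity)
    \<comment> \<open>Each pair of ranges for \<open>v\<close> differs only in which argument of the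
      outer \<open>max\<close> wins: the fixed bound first, then \<open>v\<close>.\<close>
    subgoal for k v using C_range[of k] by (subst even_pert) (auto simp: max_absorb2)
    subgoal for k v using C_range[of k] by (subst even_pert) (auto simp: max_absorb1)
    subgoal by (simp add: dil_coeff_parity)
    subgoal for k v using D_range[of k] by (subst odd_pert) (auto simp: max_absorb2)
    subgoal for k v using D_range[of k] by (subst odd_pert) (auto simp: max_absorb1)
    subgoal by (simp add: dil_coeff_parity)
    subgoal for n v using E_range[of n] by (subst even_pert) (auto simp: max_absorb2)
    subgoal for n v using E_range[of n] by (subst even_pert) (auto simp: max_absorb1)
    subgoal by (simp add: dil_coeff_parity)
    subgoal for n v using E_range[of n] by (subst odd_pert) (auto simp: max_absorb2)
    subgoal for n v using E_range[of n] by (subst odd_pert) (auto simp: max_absorb1)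
    done
qed

end
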